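(* Let $G$ be a finite abelian group, $X$ a finite $G$-set with $|X|=v$, and $\widehat X$ a normalized $G$-dual set of $X$. A nonempty subset $D\subseteq X$ is a $G$--$(v,k,\ell)$ difference set of $X$ if and only if for every non-principal $\psi\in\widehat G$, $$\sum_{\lambda\in\widehat X_\psi}\Big|\sum_{x\in D}\lambda(x)\Big|^2=\frac{|X|}{|G|}(k-\ell).$$
   Context: A subset $D$ of $X$ with $|D|=k$ is a $G$--$(v,k,\ell)$ difference set if for every $\alpha\in G\setminus\{1_G\}$ there are exactly $\ell$ pairs $(x_1,x_2)\in D\times D$ with $\alpha x_1=x_2$. $\widehat G$ is the group of complex linear characters of $G$, $\psi_0$ the principal one. $\mathbb C^X$ has inner product $\langle f,g\rangle=\sum_x f(x)\overline{g(x)}$; $f\in\mathbb C^X$ is $\psi$-linear if $f(\alpha^{-1}x)=\psi(\alpha)f(x)$ for all $\alpha,x$. A $G$-dual set is a basis $\widehat X$ of $\mathbb C^X$ with $\langle\lambda,\lambda'\rangle=|X|\delta_{\lambda,\lambda'}$, each element $\psi$-linear for some $\psi\in\widehat G$, closed under conjugation; $\widehat X_\psi$ is its set of $\psi$-linear elements. With orbits $X_j$ and pointwise stabilizers $N_j$, a normalized $G$-dual set is a $G$-dual set such that: each $\lambda$ is nonzero on exactly one orbit $X_j$; $|\lambda(x)|=\sqrt{|X|/|X_j|}$ on that orbit; $\sum_{x\in X}\lambda(x)=0$ for $\lambda\in\widehat X_\psi$, $\psi\ne\psi_0$; for each $X_j$ and $\psi$ at most one $\lambda\in\widehat X_\psi$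 is nonzero on $X_j$, and one exists iff $N_j\subseteq\ker\psi$; for each $X_j$ exactly one $\lambda\in\widehat X_{\psi_0}$ is nonzero on $X_j$. (Normalized $G$-dual sets exist for every finite $G$-set.) *)

theory Defs
  imports Complex_Main "HOL-Algebra.Group_Action" "HOL-Library.Function_Algebras"
begin

definition complex_units :: "complex monoid" where
  "complex_units = \<lparr>carrier = UNIV - {0}, monoid.mult = (*), one = 1\<rparr>"

text \<open>Homomorphisms are made extensional on the carrier, so that each linear character is
  represented by exactly one function.\<close>

definition characters :: "('g, 'm) monoid_scheme \<Rightarrow> ('g \<Rightarrow> complex) set" where
  "characters G = hom G complex_units \<inter> extensional (carrier G)"

definition principal_character :: "('g, 'm) monoid_scheme \<Rightarrow> 'g \<Rightarrow> complex" where
  "principal_character G = (\<lambda>\<alpha>\<in>carrier G. 1)"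

definition cfun_scale :: "complex \<Rightarrow> ('x \<Rightarrow> complex) \<Rightarrow> 'x \<Rightarrow> complex" where
  "cfun_scale c f = (\<lambda>x. c * f x)"

interpretation cfun: vector_space cfun_scale
  by unfold_locales (auto simp: cfun_scale_def plus_fun_def algebra_simps)

text \<open>The space of complex functions on \<open>X\<close>, as the subspace of those functions on the
  ambient type that vanish outside \<open>X\<close>.\<close>

definition cfun_space :: "'x set \<Rightarrow> ('x \<Rightarrow> complex) set" where
  "cfun_space X = {f. \<forall>x. x \<notin> X \<longrightarrow> f x = 0}"

definition cfun_inner :: "'x set \<Rightarrow> ('x \<Rightarrow> complex) \<Rightarrow> ('x \<Rightarrow> complex) \<Rightarrow> complex" where
  "cfun_inner X f g = (\<Sum>x\<in>X. f x * cnj (g x))"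

definition char_linear ::
  "('g, 'm) monoid_scheme \<Rightarrow> 'x set \<Rightarrow> ('g \<Rightarrow> 'x \<Rightarrow> 'x) \<Rightarrow> ('g \<Rightarrow> complex) \<Rightarrow> ('x \<Rightarrow> complex) \<Rightarrow> bool"
  where "char_linear G X \<phi> \<psi> f \<longleftrightarrow>
    f \<in> cfun_space X \<and> (\<forall>\<alpha>\<in>carrier G. \<forall>x\<in>X. f (\<phi> (inv\<^bsub>G\<^esub> \<alpha>) x) = \<psi> \<alpha> * f x)"

definition dual_set ::
  "('g, 'm) monoid_scheme \<Rightarrow> 'x set \<Rightarrow> ('g \<Rightarrow> 'x \<Rightarrow> 'x) \<Rightarrow> ('x \<Rightarrow> complex) set \<Rightarrow> bool"
  where "dual_set G X \<phi> L \<longleftrightarrow>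
    cfun.independent L \<and> cfun.span L = cfun_space X \<and>
    (\<forall>f\<in>L. \<forall>g\<in>L. cfun_inner X f g = (if f = g then of_nat (card X) else 0)) \<and>
    (\<forall>f\<in>L. \<exists>\<psi>\<in>characters G. char_linear G X \<phi> \<psi> f) \<and>
    (\<forall>f\<in>L. (\<lambda>x. cnj (f x)) \<in> L)"

definition dual_part ::
  "('g, 'm) monoid_scheme \<Rightarrow> 'x set \<Rightarrow> ('g \<Rightarrow> 'x \<Rightarrow> 'x) \<Rightarrow> ('x \<Rightarrow> complex) set
    \<Rightarrow> ('g \<Rightarrow> complex) \<Rightarrow> ('x \<Rightarrow> complex) set"
  where "dual_part G X \<phi> L \<psi> = {f \<in> L. char_linear G X \<phi> \<psi> f}"

definition pointwise_stabilizer ::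
  "('g, 'm) monoid_scheme \<Rightarrow> ('g \<Rightarrow> 'x \<Rightarrow> 'x) \<Rightarrow> 'x set \<Rightarrow> 'g set"
  where "pointwise_stabilizer G \<phi> Y = {\<alpha> \<in> carrier G. \<forall>x\<in>Y. \<phi> \<alpha> x = x}"

text \<open>Nonzero as a function on \<open>Y\<close>, that is, not identically zero there.\<close>

definition nonzero_on :: "('x \<Rightarrow> complex) \<Rightarrow> 'x set \<Rightarrow> bool" where
  "nonzero_on f Y \<longleftrightarrow> (\<exists>x\<in>Y. f x \<noteq> 0)"

definition normalized_dual_set ::
  "('g, 'm) monoid_scheme \<Rightarrow> 'x set \<Rightarrow> ('g \<Rightarrow> 'x \<Rightarrow> 'x) \<Rightarrow> ('x \<Rightarrow> complex) set \<Rightarrow> bool"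
  where "normalized_dual_set G X \<phi> L \<longleftrightarrow>
    dual_set G X \<phi> L \<and>
    (\<forall>f\<in>L. \<exists>!Y. Y \<in> orbits G X \<phi> \<and> nonzero_on f Y) \<and>
    (\<forall>f\<in>L. \<forall>Y\<in>orbits G X \<phi>. nonzero_on f Y \<longrightarrow>
       (\<forall>x\<in>Y. cmod (f x) = sqrt (real (card X) / real (card Y)))) \<and>
    (\<forall>\<psi>\<in>characters G. \<psi> \<noteq> principal_character G \<longrightarrow>
       (\<forall>f\<in>dual_part G X \<phi> L \<psi>. (\<Sum>x\<in>X. f x) = 0)) \<and>
    (\<forall>Y\<in>orbits G X \<phi>. \<forall>\<psi>\<in>characters G.
       (\<exists>\<^sub>\<le>\<^sub>1 f. f \<in> dual_part G X \<phi> L \<psi> \<and> nonzero_on f Y) \<and>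
       ((\<exists>f\<in>dual_part G X \<phi> L \<psi>. nonzero_on f Y) \<longleftrightarrow>
          pointwise_stabilizer G \<phi> Y \<subseteq> kernel G complex_units \<psi>)) \<and>
    (\<forall>Y\<in>orbits G X \<phi>.
       \<exists>!f. f \<in> dual_part G X \<phi> L (principal_character G) \<and> nonzero_on f Y)"

definition difference_set ::
  "('g, 'm) monoid_scheme \<Rightarrow> 'x set \<Rightarrow> ('g \<Rightarrow> 'x \<Rightarrow> 'x) \<Rightarrow> nat \<Rightarrow> nat \<Rightarrow> nat \<Rightarrow> 'x set \<Rightarrow> bool"
  where "difference_set G X \<phi> v k l D \<longleftrightarrow>
    card X = v \<and> D \<subseteq> X \<and> card D = k \<and>
    (\<forall>\<alpha>\<in>carrier G - {\<one>\<^bsub>G\<^esub>}. card {(x1, x2) \<in> D \<times> D. \<phi> \<alpha> x1 = x2} = l)"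

end

theory Submission
  imports Defs "HOL-Algebra.Multiplicative_Group"
begin

text \<open>
  Let \<open>c \<alpha>\<close> be the number of pairs of \<open>D\<close> with difference \<open>\<alpha>\<close>. Expanding the indicator
  function of \<open>D\<close> in the orthogonal basis \<open>L\<close> and using orthogonality of characters, the Fourier
  coefficient of \<open>c\<close> at \<open>\<psi>\<close> is \<open>|G| / |X|\<close> times the sum over the \<open>\<psi>\<close>-linear part of \<open>L\<close> in the
  theorem. On the other hand \<open>D\<close> is a difference set iff \<open>\<alpha> \<mapsto> c \<alpha> - (k - l) [\<alpha> = 1]\<close> is constant,
  because its value at \<open>1\<close> is \<open>l\<close>. A function on a finite abelian group is constant iff its Fourier
  coefficients at non-principal characters vanish: from a non-constant function, successive
  projections to eigenspaces of translations produce a non-zero multiple of a non-principal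
  character, and these projections preserve the vanishing of Fourier coefficients.
\<close>

subsection \<open>Characters of a finite abelian group\<close>

context group
begin

lemma character_mult:
  assumes "\<psi> \<in> characters G" "x \<in> carrier G" "y \<in> carrier G"
  shows "\<psi> (x \<otimes> y) = \<psi> x * \<psi> y"
  using assms by (auto simp: characters_def complex_units_def hom_def)

lemma character_nonzero:
  assumes "\<psi> \<in> characters G" "x \<in> carrier G"
  shows "\<psi> x \<noteq> 0"
  using assms by (auto simp: characters_def complex_units_def hom_def)

lemma character_one:
  assumes "\<psi> \<in> characters G"
  shows "\<psi> \<one> = 1"
  using character_mult[OF assms one_closed one_closed] character_nonzero[OF assms one_closed] by simp

lemma character_inv:
  assumes "\<psi> \<in> characters G" "x \<in> carrier G"
  shows "\<psi> (inv x) = inverse (\<psi> x)"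
proof -
  have "\<psi> (inv x) * \<psi> x = 1"
    using character_mult[OF assms(1) inv_closed[OF assms(2)] assms(2)] character_one[OF assms(1)]
      assms(2) by simp
  then show ?thesis
    by (metis inverse_unique mult.commute)
qed

lemma characterI:
  assumes "\<And>x. x \<in> carrier G \<Longrightarrow> f x \<noteq> 0"
    and "\<And>x y. x \<in> carrier G \<Longrightarrow> y \<in> carrier G \<Longrightarrow> f (x \<otimes> y) = f x * f y"
  shows "restrict f (carrier G) \<in> characters G"
  using assms by (auto simp: characters_def complex_units_def hom_def)

lemma character_eqI:
  assumes "\<psi> \<in> characters G" "\<chi> \<in> characters G" "\<And>x. x \<in> carrier G \<Longrightarrow> \<psi> x = \<chi> x"
  shows "\<psi> = \<chi>"
  using assms by (auto simp: characters_def intro: extensionalityI)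

lemma principal_character_in_characters: "principal_character G \<in> characters G"
  unfolding principal_character_def by (rule characterI) auto

lemma sum_translate:
  fixes f :: "'a \<Rightarrow> 'c::comm_monoid_add"
  assumes "a \<in> carrier G"
  shows "(\<Sum>x\<in>carrier G. f (a \<otimes> x)) = (\<Sum>x\<in>carrier G. f x)"
proof (rule sum.reindex_bij_witness[of _ "\<lambda>x. inv a \<otimes> x" "\<lambda>x. a \<otimes> x"])
  show "inv a \<otimes> (a \<otimes> x) = x" if "x \<in> carrier G" for x
    using that assms by (simp flip: m_assoc)
  show "a \<otimes> (inv a \<otimes> x) = x" if "x \<in> carrier G" for x
    using that assms by (simp flip: m_assoc)
qed (use assms in auto)

text \<open>Translating the summation variable by \<open>a\<close> multiplies the sum by
  \<open>f a\<close>, which differs from 1. Only multiplicativity is asked of \<open>f\<close>, so a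
  product of two characters can be inserted without first making it extensional.\<close>

lemma sum_multiplicative_eq_0:
  fixes f :: "'a \<Rightarrow> complex"
  assumes "\<And>x y. x \<in> carrier G \<Longrightarrow> y \<in> carrier G \<Longrightarrow> f (x \<otimes> y) = f x * f y"
    and "a \<in> carrier G" "f a \<noteq> 1"
  shows "(\<Sum>x\<in>carrier G. f x) = 0"
proof -
  have "(\<Sum>x\<in>carrier G. f x) = (\<Sum>x\<in>carrier G. f (a \<otimes> x))"
    using sum_translate[OF assms(2), of f] by simp
  also have "\<dots> = f a * (\<Sum>x\<in>carrier G. f x)"
    using assms by (simp add: sum_distrib_left)
  finally show ?thesis
    using assms(3) by simp
qed

lemma sum_nonprincipal_character:
  assumes "\<psi> \<in> characters G" "\<psi> \<noteq> principal_character G"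
  shows "(\<Sum>x\<in>carrier G. \<psi> x) = 0"
proof -
  obtain a where "a \<in> carrier G" "\<psi> a \<noteq> 1"
    using character_eqI[OF assms(1) principal_character_in_characters] assms(2)
    by (auto simp: principal_character_def)
  then show ?thesis
    using sum_multiplicative_eq_0 character_mult[OF assms(1)] by blast
qed

text \<open>For a root of unity \<open>z\<close> with \<open>z ^ order G = 1\<close> and a finite
  group, this is \<open>order G\<close> times the projection of \<open>f\<close> to the functions
  that translation by \<open>a\<close> multiplies by \<open>inverse z\<close>. The exponent is the
  order of the group rather than that of \<open>a\<close>, so that one set of roots serves every
  \<open>a\<close>.\<close>

definition eigencomponent :: "'a \<Rightarrow> complex \<Rightarrow> ('a \<Rightarrow> complex) \<Rightarrow> 'a \<Rightarrow> complex" where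
  "eigencomponent a z f x = (\<Sum>i<order G. z ^ i * f (a [^] i \<otimes> x))"

lemma eigencomponent_translate:
  assumes "finite (carrier G)" "a \<in> carrier G" "x \<in> carrier G" "z ^ order G = 1"
  shows "z * eigencomponent a z f (a \<otimes> x) = eigencomponent a z f x"
proof -
  let ?g = "\<lambda>i. z ^ i * f (a [^] i \<otimes> x)"
  have "z * eigencomponent a z f (a \<otimes> x) = (\<Sum>i<order G. ?g (Suc i))"
    using assms(2,3) by (simp add: eigencomponent_def sum_distrib_left mult.assoc flip: m_assoc)
  \<comment> \<open>The sum over \<open>i \<le> order G\<close> is split off at either end. The two
    end terms agree because both \<open>z\<close> and \<open>a\<close> have trivial
    \<open>order G\<close>-th power.\<close>
  moreover have "(\<Sum>i<order G. ?g (Suc i)) + ?g 0 = (\<Sum>i<order G. ?g i) + ?g (order G)"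
    using sum.lessThan_Suc[of ?g "order G"] sum.lessThan_Suc_shift[of ?g "order G"]
    by (simp only: add.commute)
  moreover have "?g (order G) = ?g 0"
    using assms pow_order_eq_1 by simp
  ultimately show ?thesis
    by (simp add: eigencomponent_def)
qed

end

text \<open>For \<open>0 < i < n\<close> there are fewer \<open>i\<close>-th than
  \<open>n\<close>-th roots of unity, so some \<open>n\<close>-th root \<open>w\<close> has
  \<open>w ^ i \<noteq> 1\<close>. Multiplication by \<open>w\<close> permutes the
  \<open>n\<close>-th roots and scales the sum by \<open>w ^ i\<close>.\<close>

lemma sum_roots_unity_power:
  assumes "i < n"
  shows "(\<Sum>z | z ^ n = 1. z ^ i) = (if i = 0 then of_nat n else (0::complex))"
proof (cases "i = 0")
  case True
  then show ?thesis
    using assms by (simp add: card_roots_unity_eq)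
next
  case False
  have "card {z::complex. z ^ i = 1} < card {z::complex. z ^ n = 1}"
    using assms False by (simp add: card_roots_unity_eq)
  moreover have "finite {z::complex. z ^ i = 1}"
    using False by (intro finite_roots_unity) simp
  ultimately obtain w :: complex where w: "w ^ n = 1" "w ^ i \<noteq> 1"
    by (metis (mono_tags, lifting) card_mono linorder_not_le mem_Collect_eq subsetI)
  have w0: "w \<noteq> 0"
    using w(1) assms by (auto simp: power_0_left)
  have "(\<Sum>z | z ^ n = 1. z ^ i) = (\<Sum>z | z ^ n = 1. (w * z) ^ i)"
    by (rule sum.reindex_bij_witness[of _ "\<lambda>z. w * z" "\<lambda>z. z / w"])
      (use w w0 in \<open>auto simp: power_mult_distrib power_divide\<close>)
  also have "\<dots> = w ^ i * (\<Sum>z | z ^ n = 1. z ^ i)"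
    by (simp add: power_mult_distrib sum_distrib_left)
  finally show ?thesis
    using w(2) False by simp
qed

section \<open>Decomposition into eigencomponents and vanishing Fourier coefficients\<close>

context group
begin

text \<open>Fourier inversion along the powers of \<open>a\<close>: after the sums are exchanged,
  only the exponent 0 survives the summation over the roots of unity. Hence a nonzero function has a
  nonzero eigencomponent.\<close>

lemma sum_eigencomponents:
  assumes "finite (carrier G)" "a \<in> carrier G" "x \<in> carrier G"
  shows "(\<Sum>z | z ^ order G = 1. eigencomponent a z f x) = of_nat (order G) * f x"
proof -
  have pos: "0 < order G"
    using assms(1) order_gt_0_iff_finite by blast
  have "(\<Sum>z | z ^ order G = 1. eigencomponent a z f x)
      = (\<Sum>i<order G. (\<Sum>z | z ^ order G = 1. z ^ i) * f (a [^] i \<otimes> x))"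
    unfolding eigencomponent_def by (subst sum.swap) (simp add: sum_distrib_right)
  also have "\<dots> = (\<Sum>i<order G. if i = 0 then of_nat (order G) * f x else 0)"
    using assms by (intro sum.cong) (auto simp: sum_roots_unity_power)
  finally show ?thesis
    using pos by simp
qed

text \<open>The coefficients are taken against \<open>\<psi>\<close> instead of its conjugate.
  Inversion permutes the non-principal characters, so the condition is the same.\<close>

definition nonprincipal_coefficients_vanish :: "('a \<Rightarrow> complex) \<Rightarrow> bool" where
  "nonprincipal_coefficients_vanish f \<longleftrightarrow>
    (\<forall>\<psi>\<in>characters G. \<psi> \<noteq> principal_character G \<longrightarrow> (\<Sum>x\<in>carrier G. f x * \<psi> x) = 0)"

text \<open>Translating \<open>f\<close> by \<open>b\<close> only divides its coefficient at
  \<open>\<psi>\<close> by \<open>\<psi> b\<close>, and an eigencomponent is a linear combination of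
  translates.\<close>

lemma eigencomponent_coefficients_vanish:
  assumes "nonprincipal_coefficients_vanish f" "a \<in> carrier G"
  shows "nonprincipal_coefficients_vanish (eigencomponent a z f)"
  unfolding nonprincipal_coefficients_vanish_def
proof (intro ballI impI)
  fix \<psi> assume \<psi>: "\<psi> \<in> characters G" "\<psi> \<noteq> principal_character G"
  have "(\<Sum>x\<in>carrier G. f (b \<otimes> x) * \<psi> x) = 0" if b: "b \<in> carrier G" for b
  proof -
    have "\<psi> b * (\<Sum>x\<in>carrier G. f (b \<otimes> x) * \<psi> x)
        = (\<Sum>x\<in>carrier G. f (b \<otimes> x) * \<psi> (b \<otimes> x))"
      using \<psi> b by (simp add: sum_distrib_left character_mult mult_ac)
    also have "\<dots> = 0"
      using sum_translate[OF b, of "\<lambda>x. f x * \<psi> x"] assms(1) \<psi>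
      by (simp add: nonprincipal_coefficients_vanish_def)
    finally show ?thesis
      using character_nonzero[OF \<psi>(1) b] by simp
  qed
  moreover have "(\<Sum>x\<in>carrier G. eigencomponent a z f x * \<psi> x)
      = (\<Sum>i<order G. z ^ i * (\<Sum>x\<in>carrier G. f (a [^] i \<otimes> x) * \<psi> x))"
    unfolding eigencomponent_def sum_distrib_right
    by (subst sum.swap) (simp add: sum_distrib_left mult.assoc)
  ultimately show "(\<Sum>x\<in>carrier G. eigencomponent a z f x * \<psi> x) = 0"
    using assms(2) by simp
qed

end

section \<open>Common eigenfunctions of all translations, and constant functions\<close>

context comm_group
begin

text \<open>Translations commute in an abelian group, so projecting for \<open>a\<close> keeps an
  eigenfunction of translation by \<open>g\<close>, with the same eigenvalue.\<close>

lemma eigencomponent_eigenfunction: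
  assumes "a \<in> carrier G" "g \<in> carrier G" "x \<in> carrier G"
    and "\<And>y. y \<in> carrier G \<Longrightarrow> f (g \<otimes> y) = w * f y"
  shows "eigencomponent a z f (g \<otimes> x) = w * eigencomponent a z f x"
proof -
  have "f (a [^] i \<otimes> (g \<otimes> x)) = w * f (a [^] i \<otimes> x)" for i :: nat
    using assms(4)[of "a [^] i \<otimes> x"] assms(1-3) by (simp add: m_lcomm)
  then show ?thesis
    by (simp add: eigencomponent_def sum_distrib_left mult_ac)
qed

text \<open>Simultaneous diagonalization, one element of \<open>S\<close> at a time: some
  eigencomponent of the current function for the new element is nonzero, and passing to it keeps all
  earlier eigenvalues. The eigenvalue \<open>w\<close> at \<open>a\<close> is prescribed, because it
  will show that the resulting character is non-principal.\<close>

lemma exists_common_eigenfunction: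
  assumes fin: "finite (carrier G)" and "finite S" "S \<subseteq> carrier G"
    and a: "a \<in> carrier G" and f: "nonprincipal_coefficients_vanish f"
      "\<exists>x\<in>carrier G. f x \<noteq> 0" "\<And>x. x \<in> carrier G \<Longrightarrow> f (a \<otimes> x) = w * f x"
  shows "\<exists>h. nonprincipal_coefficients_vanish h \<and> (\<exists>x\<in>carrier G. h x \<noteq> 0) \<and>
    (\<forall>x\<in>carrier G. h (a \<otimes> x) = w * h x) \<and>
    (\<forall>g\<in>S. \<exists>u. \<forall>x\<in>carrier G. h (g \<otimes> x) = u * h x)"
  using assms(2,3)
proof (induction S rule: finite_induct)
  case empty
  then show ?case using f by blast
next
  case (insert b S)
  then have b: "b \<in> carrier G" by simp
  from insert obtain h x where h: "nonprincipal_coefficients_vanish h"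
      "x \<in> carrier G" "h x \<noteq> 0" "\<forall>x\<in>carrier G. h (a \<otimes> x) = w * h x"
      "\<forall>g\<in>S. \<exists>u. \<forall>x\<in>carrier G. h (g \<otimes> x) = u * h x"
    by auto
  have pos: "0 < order G"
    using fin order_gt_0_iff_finite by blast
  have "(\<Sum>z | z ^ order G = 1. eigencomponent b z h x) \<noteq> 0"
    using sum_eigencomponents[OF fin b h(2)] h(3) pos by simp
  then obtain z where z: "z ^ order G = 1" "eigencomponent b z h x \<noteq> 0"
    by (metis (mono_tags, lifting) mem_Collect_eq sum.neutral)
  have "z \<noteq> 0"
    using z(1) pos by (auto simp: power_0_left)
  then have "eigencomponent b z h (b \<otimes> y) = inverse z * eigencomponent b z h y"
    if "y \<in> carrier G" for y
    using eigencomponent_translate[OF fin b that z(1), of h] by (simp add: field_simps)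
  moreover have "\<exists>u. \<forall>y\<in>carrier G. eigencomponent b z h (g \<otimes> y) = u * eigencomponent b z h y"
    if "g \<in> S" for g
  proof -
    obtain u where "\<And>y. y \<in> carrier G \<Longrightarrow> h (g \<otimes> y) = u * h y"
      using bspec[OF h(5) \<open>g \<in> S\<close>] by (elim exE) (blast dest: bspec)
    moreover have "g \<in> carrier G"
      using insert.prems \<open>g \<in> S\<close> by auto
    ultimately show ?thesis
      using eigencomponent_eigenfunction[OF b, where g = g and f = h and w = u] by auto
  qed
  moreover have "\<forall>y\<in>carrier G. eigencomponent b z h (a \<otimes> y) = w * eigencomponent b z h y"
    using h(4) eigencomponent_eigenfunction[OF b a, where f = h and w = w] by auto
  ultimately show ?case
    using eigencomponent_coefficients_vanish[OF h(1) b] z(2) h(2)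
    by (intro exI[of _ "eigencomponent b z h"]) auto
qed

lemma constant_if_nonprincipal_coefficients_vanish:
  assumes fin: "finite (carrier G)" and f: "nonprincipal_coefficients_vanish f"
    and a: "a \<in> carrier G"
  shows "f a = f \<one>"
proof (rule ccontr)
  assume neq: "f a \<noteq> f \<one>"
  let ?Z = "{z::complex. z ^ order G = 1}"
  have pos: "0 < order G"
    using fin order_gt_0_iff_finite by blast
  have finZ: "finite ?Z"
    using pos by (intro finite_roots_unity) simp
  \<comment> \<open>If only the component for \<open>z = 1\<close> were nonzero, \<open>f\<close>
    would be a multiple of it and hence invariant under translation by \<open>a\<close>.\<close>
  have "\<exists>z\<in>?Z. z \<noteq> 1 \<and> (\<exists>x\<in>carrier G. eigencomponent a z f x \<noteq> 0)"
  proof (rule ccontr)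
    assume none: "\<not> ?thesis"
    have eq: "of_nat (order G) * f x = eigencomponent a 1 f x" if x: "x \<in> carrier G" for x
    proof -
      have "of_nat (order G) * f x = (\<Sum>z\<in>?Z. eigencomponent a z f x)"
        using sum_eigencomponents[OF fin a x] by simp
      also have "\<dots> = (\<Sum>z\<in>?Z. if z = 1 then eigencomponent a 1 f x else 0)"
        using none x by (intro sum.cong) auto
      finally show ?thesis
        using finZ by simp
    qed
    have "of_nat (order G) * f a = of_nat (order G) * f \<one>"
      using eq[OF a] eq[OF one_closed] eigencomponent_translate[OF fin a one_closed, of 1 f] a by simp
    then show False
      using neq pos by simp
  qed
  then obtain z where z: "z ^ order G = 1" "z \<noteq> 1" "\<exists>x\<in>carrier G. eigencomponent a z f x \<noteq> 0"
    by blast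
  have z0: "z \<noteq> 0"
    using z(1) pos by (auto simp: power_0_left)
  have "eigencomponent a z f (a \<otimes> x) = inverse z * eigencomponent a z f x"
    if "x \<in> carrier G" for x
    using eigencomponent_translate[OF fin a that z(1), of f] z0 by (simp add: field_simps)
  from exists_common_eigenfunction[where f = "eigencomponent a z f" and w = "inverse z",
      OF fin fin subset_refl a eigencomponent_coefficients_vanish[OF f a] z(3) this]
  obtain h x0 where h: "nonprincipal_coefficients_vanish h" "x0 \<in> carrier G" "h x0 \<noteq> 0"
      "\<forall>x\<in>carrier G. h (a \<otimes> x) = inverse z * h x"
      "\<forall>g\<in>carrier G. \<exists>u. \<forall>x\<in>carrier G. h (g \<otimes> x) = u * h x"
    by blast
  then obtain u where u: "\<And>g x. g \<in> carrier G \<Longrightarrow> x \<in> carrier G \<Longrightarrow> h (g \<otimes> x) = u g * h x"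
    by metis
  \<comment> \<open>Since \<open>h x0 = u x0 * h \<one>\<close>, the nonzero value can be moved to
    the identity. All of \<open>h\<close> is then \<open>h \<one>\<close> times its eigenvalue
    function \<open>u\<close>, which is therefore multiplicative.\<close>
  have h1: "h \<one> \<noteq> 0"
    using u[OF h(2) one_closed] h(2,3) by auto
  have u0: "u g \<noteq> 0" if g: "g \<in> carrier G" for g
    using u[OF g inv_closed[OF g]] h1 g by auto
  have umult: "u (x \<otimes> y) = u x * u y" if "x \<in> carrier G" "y \<in> carrier G" for x y
  proof -
    have "u (x \<otimes> y) * h \<one> = h (x \<otimes> (y \<otimes> \<one>))"
      using u[of "x \<otimes> y" \<one>] that by simp
    also have "\<dots> = u x * u y * h \<one>"
      using u[of x "y \<otimes> \<one>"] u[of y \<one>] that by (metis m_closed mult.assoc one_closed)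
    finally show ?thesis
      using h1 by auto
  qed
  \<comment> \<open>The inverse makes \<open>h x * \<psi> x\<close> constantly
    \<open>h \<one>\<close>, so the coefficient of \<open>h\<close> at \<open>\<psi>\<close> is
    \<open>order G * h \<one>\<close>, which is nonzero. As \<open>\<psi> a = z \<noteq> 1\<close>,
    this coefficient ought to vanish.\<close>
  define \<psi> where "\<psi> = (\<lambda>x\<in>carrier G. inverse (u x))"
  have \<psi>: "\<psi> \<in> characters G"
    unfolding \<psi>_def by (rule characterI) (use u0 umult in auto)
  have "u a = inverse z"
    using u[OF a one_closed] h(4) h1 by auto
  then have "\<psi> a \<noteq> principal_character G a"
    using a z(2) by (simp add: \<psi>_def principal_character_def)
  then have "(\<Sum>x\<in>carrier G. h x * \<psi> x) = 0"
    using h(1) \<psi> unfolding nonprincipal_coefficients_vanish_def by metis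
  moreover have "(\<Sum>x\<in>carrier G. h x * \<psi> x) = (\<Sum>x\<in>carrier G. h \<one>)"
  proof (rule sum.cong[OF refl])
    show "h x * \<psi> x = h \<one>" if "x \<in> carrier G" for x
      using u[OF that one_closed] u0[OF that] that by (simp add: \<psi>_def)
  qed
  ultimately show False
    using h1 pos by (simp add: order_def)
qed

lemma nonprincipal_coefficients_vanish_iff_constant:
  assumes "finite (carrier G)"
  shows "nonprincipal_coefficients_vanish f \<longleftrightarrow> (\<forall>a\<in>carrier G. f a = f \<one>)"
proof
  assume const: "\<forall>a\<in>carrier G. f a = f \<one>"
  have "(\<Sum>x\<in>carrier G. f x * \<psi> x) = f \<one> * (\<Sum>x\<in>carrier G. \<psi> x)" for \<psi>
    unfolding sum_distrib_left
    by (rule sum.cong[OF refl], drule bspec[OF const], erule arg_cong)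
  then show "nonprincipal_coefficients_vanish f"
    by (simp add: nonprincipal_coefficients_vanish_def sum_nonprincipal_character)
qed (intro ballI constant_if_nonprincipal_coefficients_vanish[OF assms])

end

subsection \<open>Expansion in a dual set\<close>

lemma sum_cfun_scale_apply: "(\<Sum>f\<in>S. cfun_scale (r f) f) x = (\<Sum>f\<in>S. r f * f x)"
  by (induction S rule: infinite_finite_induct) (auto simp: cfun_scale_def)

text \<open>The indicators of the points of \<open>X\<close> span the function space, and an
  independent set inside a finitely generated span is finite.\<close>

lemma finite_dual_set:
  assumes "finite X" "dual_set G X \<phi> L"
  shows "finite L"
proof -
  let ?\<delta> = "\<lambda>y x. if x = y then 1 else 0 :: complex"
  have "f \<in> cfun.span (?\<delta> ` X)" if f: "f \<in> cfun_space X" for f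
  proof -
    have "(\<Sum>y\<in>X. cfun_scale (f y) (?\<delta> y)) x = (\<Sum>y\<in>X. f y * ?\<delta> y x)" for x
      using assms(1) by (induction X rule: finite_induct) (auto simp: cfun_scale_def)
    moreover have "(\<Sum>y\<in>X. f y * ?\<delta> y x) = f x" for x
      using f assms(1) by (auto simp: cfun_space_def if_distrib cong: if_cong)
    ultimately have "f = (\<Sum>y\<in>X. cfun_scale (f y) (?\<delta> y))"
      by (intro ext) metis
    moreover have "(\<Sum>y\<in>X. cfun_scale (f y) (?\<delta> y)) \<in> cfun.span (?\<delta> ` X)"
      by (intro cfun.span_sum cfun.span_scale cfun.span_base) auto
    ultimately show ?thesis by simp
  qed
  moreover have "L \<subseteq> cfun_space X"
    using assms(2) cfun.span_superset unfolding dual_set_def by blast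
  ultimately show ?thesis
    using cfun.independent_span_bound[of "?\<delta> ` X" L] assms unfolding dual_set_def by blast
qed

text \<open>By orthogonality the inner product with \<open>f\<close> isolates the coefficient of
  \<open>f\<close>. The factor \<open>card X\<close> is the squared norm of each basis
  element.\<close>

lemma dual_set_expansion:
  assumes "finite X" "dual_set G X \<phi> L" "g \<in> cfun_space X"
  shows "of_nat (card X) * g x = (\<Sum>f\<in>L. cfun_inner X g f * f x)"
proof -
  have finL: "finite L"
    using finite_dual_set assms(1,2) .
  have "g \<in> cfun.span L"
    using assms(2,3) by (simp add: dual_set_def)
  then obtain r where "g = (\<Sum>f\<in>L. cfun_scale (r f) f)"
    unfolding cfun.span_finite[OF finL] by blast
  then have g: "g x = (\<Sum>f\<in>L. r f * f x)" for x
    by (simp add: sum_cfun_scale_apply)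
  have "cfun_inner X g f = r f * of_nat (card X)" if f: "f \<in> L" for f
  proof -
    have "cfun_inner X g f = (\<Sum>h\<in>L. r h * cfun_inner X h f)"
      unfolding cfun_inner_def g sum_distrib_left sum_distrib_right
      by (subst sum.swap) (simp add: mult.assoc)
    also have "\<dots> = (\<Sum>h\<in>L. if h = f then r f * of_nat (card X) else 0)"
      using assms(2) f by (intro sum.cong) (auto simp: dual_set_def)
    finally show ?thesis
      using f finL by simp
  qed
  then show ?thesis
    by (simp add: g sum_distrib_left mult_ac)
qed

section \<open>Difference counts and their Fourier coefficients\<close>

definition difference_count :: "('g \<Rightarrow> 'x \<Rightarrow> 'x) \<Rightarrow> 'x set \<Rightarrow> 'g \<Rightarrow> nat" where
  "difference_count \<phi> D \<alpha> = card {(x1, x2) \<in> D \<times> D. \<phi> \<alpha> x1 = x2}"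

lemma difference_count_eq:
  assumes "finite D"
  shows "of_nat (difference_count \<phi> D \<alpha>) = (\<Sum>x\<in>D. if \<phi> \<alpha> x \<in> D then 1 else 0 :: complex)"
proof -
  have "{(x1, x2) \<in> D \<times> D. \<phi> \<alpha> x1 = x2} = (\<lambda>x. (x, \<phi> \<alpha> x)) ` {x \<in> D. \<phi> \<alpha> x \<in> D}"
    by auto
  then have "difference_count \<phi> D \<alpha> = card {x \<in> D. \<phi> \<alpha> x \<in> D}"
    unfolding difference_count_def by (simp add: card_image inj_on_def)
  then show ?thesis
    using assms by (simp flip: sum.inter_filter)
qed

text \<open>The count is the sum over \<open>x\<close> in \<open>D\<close> of the indicator of
  \<open>D\<close> at \<open>\<phi> \<alpha> x\<close>. In the expansion of this indicator,
  linearity of \<open>f\<close> pulls out its character, leaving the sum of \<open>f\<close> over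
  \<open>D\<close> times its conjugate.\<close>

lemma difference_count_expansion:
  assumes "group G" "finite X" "dual_set G X \<phi> L" "D \<subseteq> X" "\<alpha> \<in> carrier G"
    and \<chi>: "\<And>f. f \<in> L \<Longrightarrow> char_linear G X \<phi> (\<chi> f) f"
  shows "of_nat (card X) * of_nat (difference_count \<phi> D \<alpha>)
    = (\<Sum>f\<in>L. \<chi> f (inv\<^bsub>G\<^esub> \<alpha>) * of_real ((cmod (\<Sum>x\<in>D. f x))\<^sup>2))"
proof -
  interpret group G by fact
  let ?i = "\<lambda>x. if x \<in> D then 1 else 0 :: complex"
  have i: "?i \<in> cfun_space X"
    using assms(4) by (auto simp: cfun_space_def)
  have finD: "finite D"
    using assms(2,4) finite_subset by blast
  have inner: "cfun_inner X ?i f = cnj (\<Sum>x\<in>D. f x)" for f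
  proof -
    have "cfun_inner X ?i f = (\<Sum>x\<in>X. if x \<in> D then cnj (f x) else 0)"
      unfolding cfun_inner_def by (intro sum.cong) auto
    also have "\<dots> = (\<Sum>x\<in>D. cnj (f x))"
      using assms(2,4) by (simp add: sum.If_cases Int_absorb1)
    finally show ?thesis by simp
  qed
  \<comment> \<open>Linearity is stated for the action of an inverse, so it is applied at the
    inverse of \<open>\<alpha>\<close>.\<close>
  have translate: "f (\<phi> \<alpha> x) = \<chi> f (inv\<^bsub>G\<^esub> \<alpha>) * f x" if "f \<in> L" "x \<in> D" for f x
    using \<chi>[OF that(1)] that(2) assms(4,5) inv_closed[OF assms(5)] inv_inv[OF assms(5)]
    unfolding char_linear_def by (metis subsetD)
  have "of_nat (card X) * of_nat (difference_count \<phi> D \<alpha>)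
      = (\<Sum>x\<in>D. of_nat (card X) * ?i (\<phi> \<alpha> x))"
    by (simp only: difference_count_eq[OF finD] sum_distrib_left)
  also have "\<dots> = (\<Sum>x\<in>D. \<Sum>f\<in>L. cnj (\<Sum>x\<in>D. f x) * f (\<phi> \<alpha> x))"
    by (simp only: dual_set_expansion[OF assms(2,3) i] inner)
  also have "\<dots> = (\<Sum>f\<in>L. \<Sum>x\<in>D. cnj (\<Sum>x\<in>D. f x) * f (\<phi> \<alpha> x))"
    by (rule sum.swap)
  also have "\<dots> = (\<Sum>f\<in>L. \<chi> f (inv\<^bsub>G\<^esub> \<alpha>) * ((\<Sum>x\<in>D. f x) * cnj (\<Sum>x\<in>D. f x)))"
  proof (rule sum.cong[OF refl])
    fix f assume f: "f \<in> L"
    have "(\<Sum>x\<in>D. cnj (\<Sum>x\<in>D. f x) * f (\<phi> \<alpha> x))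
        = cnj (\<Sum>x\<in>D. f x) * (\<chi> f (inv\<^bsub>G\<^esub> \<alpha>) * (\<Sum>x\<in>D. f x))"
      using translate[OF f] by (simp add: sum_distrib_left)
    then show "(\<Sum>x\<in>D. cnj (\<Sum>x\<in>D. f x) * f (\<phi> \<alpha> x))
        = \<chi> f (inv\<^bsub>G\<^esub> \<alpha>) * ((\<Sum>x\<in>D. f x) * cnj (\<Sum>x\<in>D. f x))"
      by (simp only: mult_ac)
  qed
  finally show ?thesis
    by (simp only: complex_norm_square)
qed

lemma dual_set_nonzero:
  assumes "dual_set G X \<phi> L" "finite X" "X \<noteq> {}" "f \<in> L"
  obtains x where "x \<in> X" "f x \<noteq> 0"
proof -
  have "cfun_inner X f f \<noteq> 0"
    using assms by (simp add: dual_set_def)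
  then show ?thesis
    using that unfolding cfun_inner_def by (auto elim!: sum.not_neutral_contains_not_neutral)
qed

text \<open>Orthogonality of characters removes from the expansion of the count every
  \<open>f\<close> that is not \<open>\<psi>\<close>-linear; each remaining \<open>f\<close>
  contributes with weight \<open>order G\<close>.\<close>

lemma difference_count_fourier_coefficient:
  assumes "group G" "finite (carrier G)" "finite X" "X \<noteq> {}" "dual_set G X \<phi> L" "D \<subseteq> X"
    and \<psi>: "\<psi> \<in> characters G"
  shows "of_nat (card X) * (\<Sum>\<alpha>\<in>carrier G. of_nat (difference_count \<phi> D \<alpha>) * \<psi> \<alpha>)
    = complex_of_real (real (order G) * (\<Sum>f\<in>dual_part G X \<phi> L \<psi>. (cmod (\<Sum>x\<in>D. f x))\<^sup>2))"
proof -
  interpret group G by fact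
  have finL: "finite L"
    using finite_dual_set assms(3,5) .
  have "\<forall>f\<in>L. \<exists>\<chi>\<in>characters G. char_linear G X \<phi> \<chi> f"
    using assms(5) by (simp add: dual_set_def)
  then obtain \<chi> where \<chi>: "\<And>f. f \<in> L \<Longrightarrow> \<chi> f \<in> characters G"
      "\<And>f. f \<in> L \<Longrightarrow> char_linear G X \<phi> (\<chi> f) f"
    by metis
  have orth: "(\<Sum>\<alpha>\<in>carrier G. \<chi> f (inv\<^bsub>G\<^esub> \<alpha>) * \<psi> \<alpha>)
      = (if char_linear G X \<phi> \<psi> f then of_nat (order G) else 0)" if f: "f \<in> L" for f
  proof (cases "char_linear G X \<phi> \<psi> f")
    case True
    obtain x where x: "x \<in> X" "f x \<noteq> 0"
      using dual_set_nonzero[OF assms(5,3,4) f] .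
    \<comment> \<open>A function that is nonzero at some point of \<open>X\<close> is linear for at
      most one character, so the chosen one agrees with \<open>\<psi>\<close> on the group.\<close>
    have "\<chi> f \<alpha> = \<psi> \<alpha>" if "\<alpha> \<in> carrier G" for \<alpha>
      using True \<chi>(2)[OF f] x that unfolding char_linear_def by (metis mult_right_cancel)
    then have "(\<Sum>\<alpha>\<in>carrier G. \<chi> f (inv\<^bsub>G\<^esub> \<alpha>) * \<psi> \<alpha>) = (\<Sum>\<alpha>\<in>carrier G. 1)"
      using character_inv[OF \<chi>(1)[OF f]] character_nonzero[OF \<psi>] by (intro sum.cong) auto
    then show ?thesis
      using True by (simp add: order_def)
  next
    case False
    then have "\<chi> f \<noteq> \<psi>"
      using \<chi>(2)[OF f] by auto
    then obtain a where a: "a \<in> carrier G" "\<chi> f a \<noteq> \<psi> a"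
      using character_eqI[OF \<chi>(1)[OF f] \<psi>] by blast
    have "\<chi> f (inv\<^bsub>G\<^esub> a) * \<psi> a \<noteq> 1"
      using a(2) character_inv[OF \<chi>(1)[OF f] a(1)] character_nonzero[OF \<chi>(1)[OF f] a(1)]
      by (metis inverse_inverse_eq inverse_unique)
    then have "(\<Sum>\<alpha>\<in>carrier G. \<chi> f (inv\<^bsub>G\<^esub> \<alpha>) * \<psi> \<alpha>) = 0"
      using a(1) character_inv[OF \<chi>(1)[OF f]] character_mult[OF \<chi>(1)[OF f]] character_mult[OF \<psi>]
      by (intro sum_multiplicative_eq_0[of _ a]) auto
    then show ?thesis
      using False by simp
  qed
  let ?m = "\<lambda>f. complex_of_real ((cmod (\<Sum>x\<in>D. f x))\<^sup>2)"
  have "of_nat (card X) * (\<Sum>\<alpha>\<in>carrier G. of_nat (difference_count \<phi> D \<alpha>) * \<psi> \<alpha>)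
      = (\<Sum>\<alpha>\<in>carrier G. (of_nat (card X) * of_nat (difference_count \<phi> D \<alpha>)) * \<psi> \<alpha>)"
    by (simp only: sum_distrib_left mult.assoc)
  also have "\<dots> = (\<Sum>\<alpha>\<in>carrier G. (\<Sum>f\<in>L. \<chi> f (inv\<^bsub>G\<^esub> \<alpha>) * ?m f) * \<psi> \<alpha>)"
    using difference_count_expansion[OF assms(1,3,5,6) _ \<chi>(2)] by (intro sum.cong) auto
  also have "\<dots> = (\<Sum>f\<in>L. ?m f * (\<Sum>\<alpha>\<in>carrier G. \<chi> f (inv\<^bsub>G\<^esub> \<alpha>) * \<psi> \<alpha>))"
    unfolding sum_distrib_right sum_distrib_left by (subst sum.swap) (simp only: mult_ac)
  also have "\<dots> = (\<Sum>f\<in>L. if char_linear G X \<phi> \<psi> f then of_nat (order G) * ?m f else 0)"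
    using orth by (intro sum.cong) auto
  also have "\<dots> = (\<Sum>f\<in>dual_part G X \<phi> L \<psi>. of_nat (order G) * ?m f)"
    unfolding dual_part_def using finL by (simp only: sum.inter_filter)
  finally show ?thesis
    by (simp add: sum_distrib_left)
qed

theorem theorem4p3:
  fixes G :: "('g, 'm) monoid_scheme" and X :: "'x set" and \<phi> :: "'g \<Rightarrow> 'x \<Rightarrow> 'x"
    and L :: "('x \<Rightarrow> complex) set" and D :: "'x set" and v k l :: nat
  assumes "comm_group G" and "finite (carrier G)"
    and "group_action G X \<phi>" and "finite X" and "card X = v"
    and "normalized_dual_set G X \<phi> L"
    and "D \<subseteq> X" and "D \<noteq> {}" and "card D = k"
  shows "difference_set G X \<phi> v k l D \<longleftrightarrow>
    (\<forall>\<psi>\<in>characters G. \<psi> \<noteq> principal_character G \<longrightarrow>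
      (\<Sum>f\<in>dual_part G X \<phi> L \<psi>. (cmod (\<Sum>x\<in>D. f x))\<^sup>2)
        = real (card X) / real (order G) * (real k - real l))"
proof -
  interpret comm_group G by fact
  interpret act: group_action G X \<phi> by fact
  have L: "dual_set G X \<phi> L"
    using assms(6) by (simp add: normalized_dual_set_def)
  have X: "X \<noteq> {}"
    using assms(7,8) by blast
  have pos: "real (card X) > 0" "real (order G) > 0"
    using X assms(2,4) order_gt_0_iff_finite by (auto simp: card_gt_0_iff)
  let ?S = "\<lambda>\<psi>. \<Sum>f\<in>dual_part G X \<phi> L \<psi>. (cmod (\<Sum>x\<in>D. f x))\<^sup>2"
  define c where "c = difference_count \<phi> D"
  \<comment> \<open>The difference of \<open>k\<close> and \<open>l\<close> is formed in the complex
    numbers, since \<open>l\<close> may exceed \<open>k\<close> and subtraction of naturals would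
    truncate. At the identity the count is \<open>k\<close>, so the corrected value is
    \<open>l\<close>.\<close>
  define d :: "'g \<Rightarrow> complex"
    where "d \<alpha> = of_nat (c \<alpha>) - (if \<alpha> = \<one>\<^bsub>G\<^esub> then of_nat k - of_nat l else 0)" for \<alpha>
  have "\<phi> \<one>\<^bsub>G\<^esub> x = x" if "x \<in> X" for x
    using act.id_eq_one that by (metis restrict_apply')
  then have "of_nat (c \<one>\<^bsub>G\<^esub>) = (\<Sum>x\<in>D. 1 :: complex)"
    unfolding c_def difference_count_eq[OF finite_subset[OF assms(7,4)]]
    using assms(7) by (intro sum.cong) auto
  then have d1: "d \<one>\<^bsub>G\<^esub> = of_nat l"
    using assms(9) by (simp add: d_def)
  have "difference_set G X \<phi> v k l D \<longleftrightarrow> (\<forall>\<alpha>\<in>carrier G - {\<one>\<^bsub>G\<^esub>}. c \<alpha> = l)"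
    using assms(5,7,9) by (simp add: difference_set_def c_def difference_count_def)
  also have "\<dots> \<longleftrightarrow> (\<forall>\<alpha>\<in>carrier G. d \<alpha> = d \<one>\<^bsub>G\<^esub>)"
    unfolding d1 using d1 by (auto simp: d_def)
  also have "\<dots> \<longleftrightarrow> nonprincipal_coefficients_vanish d"
    using nonprincipal_coefficients_vanish_iff_constant[OF assms(2)] by blast
  also have "\<dots> \<longleftrightarrow> (\<forall>\<psi>\<in>characters G. \<psi> \<noteq> principal_character G \<longrightarrow>
      ?S \<psi> = real (card X) / real (order G) * (real k - real l))"
  proof -
    have "(\<Sum>\<alpha>\<in>carrier G. d \<alpha> * \<psi> \<alpha>) = 0 \<longleftrightarrow>
        ?S \<psi> = real (card X) / real (order G) * (real k - real l)" if \<psi>: "\<psi> \<in> characters G" for \<psi>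
    proof -
      \<comment> \<open>The correction is supported at the identity, where every character is 1, so
        it lowers each coefficient by the same amount.\<close>
      have "(\<Sum>\<alpha>\<in>carrier G. d \<alpha> * \<psi> \<alpha>) = (\<Sum>\<alpha>\<in>carrier G. of_nat (c \<alpha>) * \<psi> \<alpha>)
          - (\<Sum>\<alpha>\<in>carrier G. if \<alpha> = \<one>\<^bsub>G\<^esub> then (of_nat k - of_nat l) * \<psi> \<one>\<^bsub>G\<^esub> else 0)"
        unfolding sum_subtractf[symmetric]
        by (intro sum.cong) (auto simp: d_def left_diff_distrib)
      also have "\<dots> = (\<Sum>\<alpha>\<in>carrier G. of_nat (c \<alpha>) * \<psi> \<alpha>) - (of_nat k - of_nat l)"
        using assms(2) character_one[OF \<psi>] by simp
      finally have eq: "of_nat (card X) * (\<Sum>\<alpha>\<in>carrier G. d \<alpha> * \<psi> \<alpha>)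
          = complex_of_real (real (order G) * ?S \<psi> - real (card X) * (real k - real l))"
        using difference_count_fourier_coefficient[OF is_group assms(2,4) X L assms(7) \<psi>]
        by (simp add: c_def right_diff_distrib)
      \<comment> \<open>Scaled by \<open>card X\<close>, the coefficient is the embedding of a real
        number, so its vanishing is a real equation.\<close>
      have "(\<Sum>\<alpha>\<in>carrier G. d \<alpha> * \<psi> \<alpha>) = 0 \<longleftrightarrow>
          of_nat (card X) * (\<Sum>\<alpha>\<in>carrier G. d \<alpha> * \<psi> \<alpha>) = 0"
        using pos(1) by auto
      also have "\<dots> \<longleftrightarrow> real (order G) * ?S \<psi> - real (card X) * (real k - real l) = 0"
        unfolding eq by (rule of_real_eq_0_iff)
      finally show ?thesis
        using pos(2) by (auto simp: field_simps)
    qed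
    then show ?thesis
      unfolding nonprincipal_coefficients_vanish_def by blast
  qed
  finally show ?thesis .
qed

end
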